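(* Let $n\ge 1$ and let $\varphi\in ZL_0^2(NF^{n,n},NF^{n,n})$ be an arbitrary infinitesimal deformation of $NF^{n,n}$. Then there are scalars $\alpha_{j,k}$ ($1\le j,k\le n$) and $\beta_{j,k}$ ($1\le j,k\le n$, $(j,k)\ne(n,1)$) in $F$ such that $\varphi$ has the following form (values on pairs of basis elements not listed being zero): $$\begin{cases} \varphi(y_j,y_1)=\sum_{k=1}^n\alpha_{j,k}x_k, & 1\le j\le n,\\ \varphi(x_j,y_1)=\sum_{k=1}^n\beta_{j,k}y_k, & 1\le j\le n-1,\\ \varphi(x_n,y_1)=\sum_{k=2}^n\beta_{n,k}y_k, &\\ \varphi(x_j,x_1)=-\alpha_{1,1}x_{j+1}+\sum_{k=1}^n(\alpha_{j+1,k}+2\beta_{j,k})x_k, & 1\le j\le n-1,\\ \varphi(x_n,x_1)=2\sum_{k=2}^n\beta_{n,k}x_k, &\\ \varphi(y_j,x_1)=2\beta_{j,1}y_1-\alpha_{1,1}y_{j+1}+\sum_{k=2}^n(\alpha_{j,k-1}+2\beta_{j,k})y_k, & 1\le j\le n-1,\\ \varphi(y_n,x_1)=\sum_{k=2}^n(\alpha_{n,k-1}+2\beta_{n,k})y_k, &\\ \varphi(x_i,x_{j+1})=-(\alpha_{j+1,1}+2\beta_{j,1})x_{i+1}, & 1\le i\le n-1,\ 1\le j\le n-1,\\ \varphi(y_i,x_{j+1})=-(\alpha_{j+1,1}+2\beta_{j,1})y_{i+1}, & 1\le i\le n-1,\ 1\le j\le n-1,\\ \varphi(x_i,y_{j+1})=-\beta_{j,1}y_{i+1},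 & 1\le i\le n-1,\ 1\le j\le n-1,\\ \varphi(y_i,y_{j+1})=-2\beta_{j,1}x_i, & 1\le i\le n,\ 1\le j\le n-1. \end{cases}$$
   Context: $F$ is a field of characteristic zero. $NF^{n,n}$ is the Leibniz superalgebra with even basis $x_1,\dots,x_n$, odd basis $y_1,\dots,y_n$ and products $[y_i,y_1]=x_i$ ($1\le i\le n$), $[x_i,y_1]=\frac12y_{i+1}$, $[y_i,x_1]=y_{i+1}$, $[x_i,x_1]=x_{i+1}$ ($1\le i\le n-1$), all other products of basis elements being zero. For a Leibniz superalgebra $L=L_0\oplus L_1$ (a $\mathbb Z_2$-graded algebra with $[x,[y,z]]=[[x,y],z]-(-1)^{|y||z|}[[x,z],y]$), the space $ZL_0^2(L,L)$ of even 2-cocycles (infinitesimal deformations) consists of the bilinear maps $\varphi:L\times L\to L$ with $\varphi(L_a,L_b)\subseteq L_{a+b}$ such that for all homogeneous $x,y,z\in L$ $$[x,\varphi(y,z)]-[\varphi(x,y),z]+(-1)^{|y||z|}[\varphi(x,z),y]+\varphi(x,[y,z])-\varphi([x,y],z)+(-1)^{|y||z|}\varphi([x,z],y)=0.$$ *)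

theory Defs
  imports Complex_Main "HOL-Library.Function_Algebras" "HOL-Library.Z2"
begin

section \<open>Leibniz superalgebras and their even 2-cocycles\<close>

text \<open>
  A superalgebra is given by its homogeneous parts \<open>L 0\<close> and \<open>L 1\<close>, indexed by the type
  \<^typ>\<open>bit\<close> of integers mod 2 and lying in an ambient vector space. The algebra itself is the
  subspace \<open>whole L\<close>; values of the bracket and of cochains outside it are irrelevant.
\<close>

definition whole :: "(bit \<Rightarrow> 'v::ab_group_add set) \<Rightarrow> 'v set"
  where "whole L = {u + v |u v. u \<in> L 0 \<and> v \<in> L 1}"

definition sign :: "bit \<Rightarrow> bit \<Rightarrow> 'f::ring_1"
  where "sign a b = (if a = 1 \<and> b = 1 then - 1 else 1)"

definition bilinear_on ::
    "('f \<Rightarrow> 'v \<Rightarrow> 'v) \<Rightarrow> 'v::ab_group_add set \<Rightarrow> ('v \<Rightarrow> 'v \<Rightarrow> 'v) \<Rightarrow> bool"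
  where "bilinear_on scale V f \<longleftrightarrow>
    (\<forall>u\<in>V. \<forall>v\<in>V. f u v \<in> V) \<and>
    (\<forall>u\<in>V. \<forall>v\<in>V. \<forall>w\<in>V. f (u + v) w = f u w + f v w \<and> f u (v + w) = f u v + f u w) \<and>
    (\<forall>c. \<forall>u\<in>V. \<forall>v\<in>V. f (scale c u) v = scale c (f u v) \<and> f u (scale c v) = scale c (f u v))"

definition even_map :: "(bit \<Rightarrow> 'v set) \<Rightarrow> ('v \<Rightarrow> 'v \<Rightarrow> 'v) \<Rightarrow> bool"
  where "even_map L f \<longleftrightarrow> (\<forall>a b. \<forall>u \<in> L a. \<forall>v \<in> L b. f u v \<in> L (a + b))"

locale leibniz_superalgebra = vector_space scale
  for scale :: "'f::field \<Rightarrow> 'v::ab_group_add \<Rightarrow> 'v" +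
  fixes L :: "bit \<Rightarrow> 'v set"
    and br :: "'v \<Rightarrow> 'v \<Rightarrow> 'v"
  assumes subspace_part: "subspace (L a)"
    and parts_disjoint: "L 0 \<inter> L 1 = {0}"
    and br_bilinear: "bilinear_on scale (whole L) br"
    and br_even: "even_map L br"
    and leibniz: "\<lbrakk>x \<in> L a; y \<in> L b; z \<in> L c\<rbrakk> \<Longrightarrow>
      br x (br y z) = br (br x y) z - scale (sign b c) (br (br x z) y)"

definition even_2cocycles ::
    "('f::field \<Rightarrow> 'v \<Rightarrow> 'v) \<Rightarrow> (bit \<Rightarrow> 'v::ab_group_add set) \<Rightarrow> ('v \<Rightarrow> 'v \<Rightarrow> 'v)
      \<Rightarrow> ('v \<Rightarrow> 'v \<Rightarrow> 'v) set"
  where "even_2cocycles scale L br = {\<phi>.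
    bilinear_on scale (whole L) \<phi> \<and> even_map L \<phi> \<and>
    (\<forall>a b c. \<forall>x \<in> L a. \<forall>y \<in> L b. \<forall>z \<in> L c.
      br x (\<phi> y z) - br (\<phi> x y) z + scale (sign b c) (br (\<phi> x z) y)
        + \<phi> x (br y z) - \<phi> (br x y) z + scale (sign b c) (\<phi> (br x z) y) = 0)}"


section \<open>The null-filiform Leibniz superalgebra\<close>

text \<open>
  The basis vectors are indexed by \<open>XI i\<close> and \<open>YI i\<close> for \<open>1 \<le> i \<le> n\<close>; a vector is its
  coordinate function, vanishing on all other indices.
\<close>

datatype nf_index = XI nat | YI nat

type_synonym 'f nf_vec = "nf_index \<Rightarrow> 'f"

definition nf_scale :: "'f::field \<Rightarrow> 'f nf_vec \<Rightarrow> 'f nf_vec"  (infixr \<open>*\<^sub>N\<close> 75)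
  where "c *\<^sub>N v = (\<lambda>p. c * v p)"

definition nf_e :: "nf_index \<Rightarrow> 'f::field nf_vec"
  where "nf_e p = (\<lambda>q. if q = p then 1 else 0)"

abbreviation nf_x :: "nat \<Rightarrow> 'f::field nf_vec"
  where "nf_x i \<equiv> nf_e (XI i)"

abbreviation nf_y :: "nat \<Rightarrow> 'f::field nf_vec"
  where "nf_y i \<equiv> nf_e (YI i)"

definition nf_indices :: "nat \<Rightarrow> bit \<Rightarrow> nf_index set"
  where "nf_indices n a = (if a = 0 then XI ` {1..n} else YI ` {1..n})"

definition nf_part :: "nat \<Rightarrow> bit \<Rightarrow> 'f::field nf_vec set"
  where "nf_part n a = {v. \<forall>p. p \<notin> nf_indices n a \<longrightarrow> v p = 0}"

fun nf_basis_br :: "nat \<Rightarrow> nf_index \<Rightarrow> nf_index \<Rightarrow> 'f::field nf_vec"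
  where
    "nf_basis_br n (YI i) (YI j) = (if j = 1 \<and> 1 \<le> i \<and> i \<le> n then nf_x i else 0)"
  | "nf_basis_br n (XI i) (YI j) =
      (if j = 1 \<and> 1 \<le> i \<and> i < n then (1/2) *\<^sub>N nf_y (i + 1) else 0)"
  | "nf_basis_br n (YI i) (XI j) = (if j = 1 \<and> 1 \<le> i \<and> i < n then nf_y (i + 1) else 0)"
  | "nf_basis_br n (XI i) (XI j) = (if j = 1 \<and> 1 \<le> i \<and> i < n then nf_x (i + 1) else 0)"

definition nf_br :: "nat \<Rightarrow> 'f::field nf_vec \<Rightarrow> 'f nf_vec \<Rightarrow> 'f nf_vec"
  where "nf_br n u v =
    (\<Sum>p \<in> nf_indices n 0 \<union> nf_indices n 1. \<Sum>q \<in> nf_indices n 0 \<union> nf_indices n 1.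
      (u p * v q) *\<^sub>N nf_basis_br n p q)"


subsection \<open>It is a Leibniz superalgebra with the prescribed products\<close>

lemma sum_fun_apply: "(\<Sum>i\<in>A. f i) q = (\<Sum>i\<in>A. f i q)"
  for f :: "'i \<Rightarrow> 'a \<Rightarrow> 'b::comm_monoid_add"
  by (induction A rule: infinite_finite_induct) auto

lemma sum_nf_indices:
  "(\<Sum>p \<in> nf_indices n 0 \<union> nf_indices n 1. f p)
    = (\<Sum>i=1..n. f (XI i)) + (\<Sum>i=1..n. f (YI i))"
  for f :: "nf_index \<Rightarrow> 'b::comm_monoid_add"
proof -
  have "(\<Sum>p \<in> nf_indices n 0 \<union> nf_indices n 1. f p)
      = (\<Sum>p \<in> XI ` {1..n}. f p) + (\<Sum>p \<in> YI ` {1..n}. f p)"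
    by (subst sum.union_disjoint) (auto simp: nf_indices_def)
  then show ?thesis
    by (simp add: sum.reindex inj_on_def)
qed

lemma nf_br_XI:
  "nf_br n u v (XI k) = (if 1 \<le> k \<and> k \<le> n then u (YI k) * v (YI 1) +
      (if 2 \<le> k then u (XI (k - 1)) * v (XI 1) else 0) else 0)"
  for u v :: "'f::field nf_vec"
proof -
  have X: "(\<Sum>j=1..n. (u (XI i) * v (XI j)) * nf_basis_br n (XI i) (XI j) (XI k))
      = (if i = k - 1 \<and> 2 \<le> k \<and> k \<le> n then u (XI i) * v (XI 1) else 0)"
    if i: "i \<in> {1..n}" for i
  proof -
    have "(\<Sum>j=1..n. (u (XI i) * v (XI j)) * nf_basis_br n (XI i) (XI j) (XI k))
      = (\<Sum>j=1..n. if j = 1 then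
          (if i = k - 1 \<and> 2 \<le> k \<and> k \<le> n then u (XI i) * v (XI 1) else 0) else 0)"
      using i by (intro sum.cong) (auto simp: nf_e_def)
    then show ?thesis using i by simp
  qed
  have Y: "(\<Sum>j=1..n. (u (YI i) * v (YI j)) * nf_basis_br n (YI i) (YI j) (XI k))
      = (if i = k then u (YI i) * v (YI 1) else 0)"
    if i: "i \<in> {1..n}" for i
  proof -
    have "(\<Sum>j=1..n. (u (YI i) * v (YI j)) * nf_basis_br n (YI i) (YI j) (XI k))
      = (\<Sum>j=1..n. if j = 1 then (if i = k then u (YI i) * v (YI 1) else 0) else 0)"
      using i by (intro sum.cong) (auto simp: nf_e_def)
    then show ?thesis using i by simp
  qed
  have "nf_br n u v (XI k) =
      (\<Sum>i=1..n. \<Sum>j=1..n. (u (XI i) * v (XI j)) * nf_basis_br n (XI i) (XI j) (XI k)) +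
      (\<Sum>i=1..n. \<Sum>j=1..n. (u (YI i) * v (YI j)) * nf_basis_br n (YI i) (YI j) (XI k))"
    unfolding nf_br_def sum_nf_indices
    by (simp add: sum_fun_apply nf_scale_def nf_e_def if_distrib[of "\<lambda>f. f _"] cong: if_cong)
  also have "\<dots> =
      (\<Sum>i=1..n. if i = k - 1 \<and> 2 \<le> k \<and> k \<le> n then u (XI i) * v (XI 1) else 0) +
      (\<Sum>i=1..n. if i = k then u (YI i) * v (YI 1) else 0)"
    using X Y by simp
  also have "(\<Sum>i=1..n. if i = k - 1 \<and> 2 \<le> k \<and> k \<le> n then u (XI i) * v (XI 1) else 0)
      = (if 2 \<le> k \<and> k \<le> n then u (XI (k - 1)) * v (XI 1) else 0)"
    by (cases "2 \<le> k \<and> k \<le> n") auto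
  finally show ?thesis by (auto simp: algebra_simps)
qed

lemma nf_br_YI:
  "nf_br n u v (YI k) = (if 2 \<le> k \<and> k \<le> n then
      u (XI (k - 1)) * v (YI 1) / 2 + u (YI (k - 1)) * v (XI 1) else 0)"
  for u v :: "'f::field nf_vec"
proof -
  have X: "(\<Sum>j=1..n. (u (XI i) * v (YI j)) * nf_basis_br n (XI i) (YI j) (YI k))
      = (if i = k - 1 \<and> 2 \<le> k \<and> k \<le> n then u (XI i) * v (YI 1) / 2 else 0)"
    if i: "i \<in> {1..n}" for i
  proof -
    have "(\<Sum>j=1..n. (u (XI i) * v (YI j)) * nf_basis_br n (XI i) (YI j) (YI k))
      = (\<Sum>j=1..n. if j = 1 then
          (if i = k - 1 \<and> 2 \<le> k \<and> k \<le> n then u (XI i) * v (YI 1) / 2 else 0) else 0)"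
      using i by (intro sum.cong) (auto simp: nf_e_def nf_scale_def)
    then show ?thesis using i by simp
  qed
  have Y: "(\<Sum>j=1..n. (u (YI i) * v (XI j)) * nf_basis_br n (YI i) (XI j) (YI k))
      = (if i = k - 1 \<and> 2 \<le> k \<and> k \<le> n then u (YI i) * v (XI 1) else 0)"
    if i: "i \<in> {1..n}" for i
  proof -
    have "(\<Sum>j=1..n. (u (YI i) * v (XI j)) * nf_basis_br n (YI i) (XI j) (YI k))
      = (\<Sum>j=1..n. if j = 1 then
          (if i = k - 1 \<and> 2 \<le> k \<and> k \<le> n then u (YI i) * v (XI 1) else 0) else 0)"
      using i by (intro sum.cong) (auto simp: nf_e_def)
    then show ?thesis using i by simp
  qed
  have "nf_br n u v (YI k) =
      (\<Sum>i=1..n. \<Sum>j=1..n. (u (XI i) * v (YI j)) * nf_basis_br n (XI i) (YI j) (YI k)) +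
      (\<Sum>i=1..n. \<Sum>j=1..n. (u (YI i) * v (XI j)) * nf_basis_br n (YI i) (XI j) (YI k))"
    unfolding nf_br_def sum_nf_indices
    by (simp add: sum_fun_apply nf_scale_def nf_e_def if_distrib[of "\<lambda>f. f _"] cong: if_cong)
  also have "\<dots> =
      (\<Sum>i=1..n. if i = k - 1 \<and> 2 \<le> k \<and> k \<le> n then u (XI i) * v (YI 1) / 2 else 0) +
      (\<Sum>i=1..n. if i = k - 1 \<and> 2 \<le> k \<and> k \<le> n then u (YI i) * v (XI 1) else 0)"
    using X Y by simp
  also have "\<dots> = (if 2 \<le> k \<and> k \<le> n then
      u (XI (k - 1)) * v (YI 1) / 2 + u (YI (k - 1)) * v (XI 1) else 0)"
    by (cases "2 \<le> k \<and> k \<le> n") auto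
  finally show ?thesis .
qed

lemma nf_vec_eqI: "u = v"
  if "\<And>k. u (XI k) = v (XI k)" "\<And>k. u (YI k) = v (YI k)" for u v :: "'f nf_vec"
proof
  show "u p = v p" for p by (cases p) (use that in auto)
qed

lemma all_nf_index: "(\<forall>p. P p) \<longleftrightarrow> (\<forall>k. P (XI k)) \<and> (\<forall>k. P (YI k))"
  by (metis nf_index.exhaust)

lemma nf_part_iff:
  "v \<in> nf_part n 0 \<longleftrightarrow> (\<forall>k. (k \<notin> {1..n} \<longrightarrow> v (XI k) = 0) \<and> v (YI k) = 0)"
  "v \<in> nf_part n 1 \<longleftrightarrow> (\<forall>k. (k \<notin> {1..n} \<longrightarrow> v (YI k) = 0) \<and> v (XI k) = 0)"
  unfolding nf_part_def nf_indices_def all_nf_index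
  by (simp_all add: image_iff) auto

lemma whole_nf_part:
  "v \<in> whole (nf_part n) \<longleftrightarrow>
    (\<forall>k. k \<notin> {1..n} \<longrightarrow> v (XI k) = 0 \<and> v (YI k) = 0)"
proof
  assume "v \<in> whole (nf_part n)"
  then show "\<forall>k. k \<notin> {1..n} \<longrightarrow> v (XI k) = 0 \<and> v (YI k) = 0"
    by (auto simp: whole_def nf_part_iff)
next
  assume v: "\<forall>k. k \<notin> {1..n} \<longrightarrow> v (XI k) = 0 \<and> v (YI k) = 0"
  define a where "a = (\<lambda>p. case p of XI k \<Rightarrow> v p | YI k \<Rightarrow> 0)"
  define b where "b = (\<lambda>p. case p of XI k \<Rightarrow> 0 | YI k \<Rightarrow> v p)"
  have "v = a + b" by (rule nf_vec_eqI) (auto simp: a_def b_def)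
  moreover have "a \<in> nf_part n 0" "b \<in> nf_part n 1"
    using v by (auto simp: nf_part_iff a_def b_def)
  ultimately show "v \<in> whole (nf_part n)" by (auto simp: whole_def)
qed

lemma nf_br_products:
  assumes "p \<in> nf_indices n a" "q \<in> nf_indices n b"
  shows "nf_br n (nf_e p) (nf_e q) = nf_basis_br n p q"
proof -
  define B where "B = nf_indices n 0 \<union> nf_indices n 1"
  have B: "finite B" "p \<in> B" "q \<in> B"
    using assms by (auto simp: B_def nf_indices_def split: if_splits)
  have "nf_br n (nf_e p) (nf_e q) = (\<Sum>p'\<in>B. \<Sum>q'\<in>B.
      if p' = p then (if q' = q then nf_basis_br n p' q' else 0) else 0)"
    unfolding nf_br_def B_def[symmetric]
    by (intro sum.cong refl) (simp add: nf_e_def nf_scale_def fun_eq_iff)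
  also have "\<dots> = (\<Sum>p'\<in>B. if p' = p then nf_basis_br n p' q else 0)"
    using B by (intro sum.cong refl) simp
  also have "\<dots> = nf_basis_br n p q"
    using B by simp
  finally show ?thesis .
qed

lemma leibniz_superalgebra_NF:
  "leibniz_superalgebra (nf_scale :: 'f::field_char_0 \<Rightarrow> _) (nf_part n) (nf_br n)"
proof -
  interpret vector_space "nf_scale :: 'f \<Rightarrow> _"
    by unfold_locales (auto simp: nf_scale_def fun_eq_iff algebra_simps)
  show ?thesis
  proof
    fix a :: bit
    show "subspace (nf_part n a)"
      by (auto simp: subspace_def nf_part_def nf_scale_def)
  next
    show "nf_part n 0 \<inter> nf_part n 1 = {0 :: 'f nf_vec}"
      by (auto simp: nf_part_iff intro: nf_vec_eqI)
  next
    show "bilinear_on nf_scale (whole (nf_part n)) (nf_br n :: 'f nf_vec \<Rightarrow> _)"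
      unfolding bilinear_on_def
      by (auto simp: whole_nf_part nf_br_XI nf_br_YI nf_scale_def field_simps intro!: nf_vec_eqI)
  next
    show "even_map (nf_part n) (nf_br n :: 'f nf_vec \<Rightarrow> _)"
      unfolding even_map_def
    proof (intro allI ballI)
      fix a b and u v :: "'f nf_vec"
      assume "u \<in> nf_part n a" "v \<in> nf_part n b"
      then show "nf_br n u v \<in> nf_part n (a + b)"
        by (cases a; cases b) (auto simp: nf_part_iff nf_br_XI nf_br_YI)
    qed
  next
    fix x y z :: "'f nf_vec" and a b c
    assume "x \<in> nf_part n a" "y \<in> nf_part n b" "z \<in> nf_part n c"
    then show "nf_br n x (nf_br n y z)
        = nf_br n (nf_br n x y) z - sign b c *\<^sub>N nf_br n (nf_br n x z) y"
      by (cases b; cases c; intro nf_vec_eqI)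
        (auto simp: nf_part_iff nf_br_XI nf_br_YI nf_scale_def sign_def field_simps)
  qed
qed

end

theory Submission
  imports Defs
begin

text \<open>
  Adding to the cocycle identity for \<open>(x, y, z)\<close> the one for \<open>(x, z, y)\<close>, weighted by the sign,
  leaves an expression for \<open>\<phi> x\<close> on \<open>[y,z] + (-1)\<^bsup>|y||z|\<^esup> [z,y]\<close> as a bracket \<open>[x, \<cdot>]\<close>. In
  \<open>NF\<close> such elements include, up to nonzero scalars, all basis vectors except \<open>x\<^sub>1\<close> and \<open>y\<^sub>1\<close>, and
  \<open>[x, v]\<close> only depends on the coordinates of \<open>v\<close> at \<open>x\<^sub>1\<close> and \<open>y\<^sub>1\<close>. Hence \<open>\<phi> x\<close> is controlled on
  those vectors; since \<open>[y\<^sub>1,y\<^sub>1] = x\<^sub>1\<close>, the identity at \<open>(x, y\<^sub>1, y\<^sub>1)\<close> then expresses \<open>\<phi> x x\<^sub>1\<close>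
  through values of \<open>\<phi>\<close> at \<open>(\<cdot>, y\<^sub>1)\<close>, which remain free except for one coordinate of \<open>\<phi> x\<^sub>n y\<^sub>1\<close>.
\<close>

section \<open>Cocycle identities in a general Leibniz superalgebra\<close>

lemma (in leibniz_superalgebra) part_subset_whole: "L a \<subseteq> whole L"
proof
  fix u assume u: "u \<in> L a"
  have z: "0 \<in> L b" for b using subspace_part by (rule subspace_0)
  show "u \<in> whole L"
  proof (cases a)
    case zero
    then have "u = u + 0 \<and> u \<in> L 0 \<and> 0 \<in> L 1" using u z by simp
    then show ?thesis unfolding whole_def by blast
  next
    case one
    then have "u = 0 + u \<and> 0 \<in> L 0 \<and> u \<in> L 1" using u z by simp
    then show ?thesis unfolding whole_def by blast
  qed
qed

lemma (in leibniz_superalgebra) whole_scale: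
  assumes "u \<in> whole L"
  shows "scale c u \<in> whole L"
proof -
  obtain v w where "u = v + w" "v \<in> L 0" "w \<in> L 1"
    using assms by (auto simp: whole_def)
  then have "scale c u = scale c v + scale c w" "scale c v \<in> L 0" "scale c w \<in> L 1"
    using subspace_part by (auto simp: scale_right_distrib subspace_scale)
  then show ?thesis by (auto simp: whole_def)
qed

lemma (in leibniz_superalgebra) cocycle_identity:
  assumes "\<phi> \<in> even_2cocycles scale L br" and "x \<in> L a" "y \<in> L b" "z \<in> L c"
  shows "br x (\<phi> y z) - br (\<phi> x y) z + scale (sign b c) (br (\<phi> x z) y)
    + \<phi> x (br y z) - \<phi> (br x y) z + scale (sign b c) (\<phi> (br x z) y) = 0"
proof -
  have "\<forall>a b c. \<forall>x\<in>L a. \<forall>y\<in>L b. \<forall>z\<in>L c.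
      br x (\<phi> y z) - br (\<phi> x y) z + scale (sign b c) (br (\<phi> x z) y)
        + \<phi> x (br y z) - \<phi> (br x y) z + scale (sign b c) (\<phi> (br x z) y) = 0"
    using assms(1) unfolding even_2cocycles_def by (elim CollectE conjE)
  from this[rule_format, OF assms(2-4)] show ?thesis .
qed

lemma (in leibniz_superalgebra) cocycle_symmetrized:
  assumes \<phi>: "\<phi> \<in> even_2cocycles scale L br"
    and x: "x \<in> L a" and y: "y \<in> L b" and z: "z \<in> L c"
  shows "\<phi> x (br y z + scale (sign b c) (br z y))
    = - br x (\<phi> y z + scale (sign b c) (\<phi> z y))"
proof -
  let ?s = "sign b c :: 'f"
  have sq: "?s * ?s = 1" and comm: "sign c b = ?s" by (auto simp: sign_def)
  have bil: "bilinear_on scale (whole L) \<phi>"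
    using \<phi> by (simp add: even_2cocycles_def)
  note coc = cocycle_identity[OF \<phi> x y z]
  note coc' = cocycle_identity[OF \<phi> x z y, unfolded comm]
  have W: "x \<in> whole L" "y \<in> whole L" "z \<in> whole L"
    using x y z part_subset_whole by blast+
  have V: "br y z \<in> whole L" "br z y \<in> whole L" "\<phi> y z \<in> whole L" "\<phi> z y \<in> whole L"
    using W br_bilinear bil unfolding bilinear_on_def by blast+
  have "\<phi> x (br y z + scale ?s (br z y)) + br x (\<phi> y z + scale ?s (\<phi> z y))
      = \<phi> x (br y z) + scale ?s (\<phi> x (br z y)) + (br x (\<phi> y z) + scale ?s (br x (\<phi> z y)))"
    using W V whole_scale br_bilinear bil unfolding bilinear_on_def by simp
  \<comment> \<open>Because the sign squares to 1, all terms containing \<open>\<phi> x y\<close>,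
    \<open>\<phi> x z\<close>, \<open>br x y\<close> or \<open>br x z\<close> cancel between the two
    identities.\<close>
  also have "\<dots> = (br x (\<phi> y z) - br (\<phi> x y) z + scale ?s (br (\<phi> x z) y)
        + \<phi> x (br y z) - \<phi> (br x y) z + scale ?s (\<phi> (br x z) y))
      + scale ?s (br x (\<phi> z y) - br (\<phi> x z) y + scale ?s (br (\<phi> x y) z)
        + \<phi> x (br z y) - \<phi> (br x z) y + scale ?s (\<phi> (br x y) z))"
    by (simp add: scale_right_distrib scale_right_diff_distrib sq)
  also have "\<dots> = 0" unfolding coc coc' by simp
  finally show ?thesis by (simp add: eq_neg_iff_add_eq_0)
qed

section \<open>Coordinates and right multiplication in NF\<close>

lemma nf_scale_apply [simp]: "(c *\<^sub>N v) p = c * v p"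
  by (simp add: nf_scale_def)

lemma nf_e_apply [simp]: "nf_e p q = (if q = p then 1 else 0)"
  by (simp add: nf_e_def)

lemma sum_nf_basis [simp]:
  assumes "finite A"
  shows "(\<Sum>k\<in>A. c k *\<^sub>N nf_x k) (XI m) = (if m \<in> A then c m else 0)"
    and "(\<Sum>k\<in>A. c k *\<^sub>N nf_x k) (YI m) = 0"
    and "(\<Sum>k\<in>A. c k *\<^sub>N nf_y k) (YI m) = (if m \<in> A then c m else 0)"
    and "(\<Sum>k\<in>A. c k *\<^sub>N nf_y k) (XI m) = 0"
  using assms by (auto simp: sum_fun_apply if_distrib[of "(*) _"] cong: if_cong)

lemma nf_basis_in_part:
  "j \<in> {1..n} \<Longrightarrow> nf_x j \<in> nf_part n 0" "j \<in> {1..n} \<Longrightarrow> nf_y j \<in> nf_part n 1"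
  by (auto simp: nf_part_iff)

lemma nf_br_even: "nf_br n x v = v (XI 1) *\<^sub>N nf_br n x (nf_x 1)" if "v \<in> nf_part n 0"
  using that by (intro nf_vec_eqI) (auto simp: nf_part_iff nf_br_XI nf_br_YI)

lemma nf_br_odd: "nf_br n x v = v (YI 1) *\<^sub>N nf_br n x (nf_y 1)" if "v \<in> nf_part n 1"
  using that by (intro nf_vec_eqI) (auto simp: nf_part_iff nf_br_XI nf_br_YI)

lemma nf_br_basis_1:
  "j \<in> {1..n} \<Longrightarrow> nf_br n (nf_y j) (nf_y 1) = nf_x j"
  "j \<in> {1..n} \<Longrightarrow> nf_br n (nf_x j) (nf_y 1) = (if j < n then (1/2) *\<^sub>N nf_y (j + 1) else 0)"
  "j \<in> {1..n} \<Longrightarrow> nf_br n (nf_y j) (nf_x 1) = (if j < n then nf_y (j + 1) else 0)"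
  "j \<in> {1..n} \<Longrightarrow> nf_br n (nf_x j) (nf_x 1) = (if j < n then nf_x (j + 1) else 0)"
  "j \<in> {1..n} \<Longrightarrow> 2 \<le> i \<Longrightarrow> nf_br n (nf_y j) (nf_x i) = 0"
  "j \<in> {1..n} \<Longrightarrow> 2 \<le> i \<Longrightarrow> nf_br n (nf_y j) (nf_y i) = 0"
  by (auto intro!: nf_vec_eqI simp: nf_br_XI nf_br_YI)

section \<open>Determining a cocycle on NF from its values at (., y_1)\<close>

locale nf_cocycle =
  fixes n :: nat and \<phi> :: "'f::field_char_0 nf_vec \<Rightarrow> 'f nf_vec \<Rightarrow> 'f nf_vec"
  assumes n: "1 \<le> n" and cocycle: "\<phi> \<in> even_2cocycles nf_scale (nf_part n) (nf_br n)"
begin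

declare One_nat_def [simp del]

sublocale leibniz_superalgebra "nf_scale :: 'f \<Rightarrow> _" "nf_part n" "nf_br n"
  by (rule leibniz_superalgebra_NF)

text \<open>Together with \<open>\<beta>\<close>, these are the scalars claimed by the
  theorem.\<close>

definition \<alpha> :: "nat \<Rightarrow> nat \<Rightarrow> 'f" where "\<alpha> j k = \<phi> (nf_y j) (nf_y 1) (XI k)"
definition \<beta> :: "nat \<Rightarrow> nat \<Rightarrow> 'f" where "\<beta> j k = \<phi> (nf_x j) (nf_y 1) (YI k)"

lemma bilinear: "bilinear_on nf_scale (whole (nf_part n)) \<phi>"
  using cocycle by (simp add: even_2cocycles_def)

lemma even_degree: "u \<in> nf_part n a \<Longrightarrow> v \<in> nf_part n b \<Longrightarrow> \<phi> u v \<in> nf_part n (a + b)"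
  using cocycle unfolding even_2cocycles_def even_map_def by blast

lemma scale_right:
  "u \<in> nf_part n a \<Longrightarrow> v \<in> nf_part n b \<Longrightarrow> \<phi> u (c *\<^sub>N v) = c *\<^sub>N \<phi> u v"
  and scale_left:
  "u \<in> nf_part n a \<Longrightarrow> v \<in> nf_part n b \<Longrightarrow> \<phi> (c *\<^sub>N u) v = c *\<^sub>N \<phi> u v"
  using bilinear part_subset_whole unfolding bilinear_on_def by blast+

lemma zero_right: "u \<in> nf_part n a \<Longrightarrow> \<phi> u 0 = 0"
  and zero_left: "u \<in> nf_part n a \<Longrightarrow> \<phi> 0 u = 0"
  using scale_right[of u a 0 0 0] scale_left[of 0 0 u a 0] subspace_part subspace_0
  by (auto simp: fun_eq_iff)

lemma apply_y_y1: "j \<in> {1..n} \<Longrightarrow> \<phi> (nf_y j) (nf_y 1) = (\<Sum>k=1..n. \<alpha> j k *\<^sub>N nf_x k)"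
  using even_degree[OF nf_basis_in_part(2)[of j] nf_basis_in_part(2)[of 1]] n
  by (intro nf_vec_eqI) (auto simp: nf_part_iff \<alpha>_def)

lemma apply_x_y1: "j \<in> {1..n} \<Longrightarrow> \<phi> (nf_x j) (nf_y 1) = (\<Sum>k=1..n. \<beta> j k *\<^sub>N nf_y k)"
  using even_degree[OF nf_basis_in_part(1)[of j] nf_basis_in_part(2)[of 1]] n
  by (intro nf_vec_eqI) (auto simp: nf_part_iff \<beta>_def)

text \<open>In the identity at (x, y_1, y_1) the sign is -1, so the paired terms double instead of
  cancelling. Of \<open>\<phi> (nf_y 1) (nf_y 1)\<close> the bracket with x sees only the x_1
  coordinate, which is \<open>\<alpha> 1 1\<close>.\<close>

lemma right_x1:
  assumes "x \<in> nf_part n a"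
  shows "\<phi> x (nf_x 1) = 2 *\<^sub>N nf_br n (\<phi> x (nf_y 1)) (nf_y 1)
    + 2 *\<^sub>N \<phi> (nf_br n x (nf_y 1)) (nf_y 1) - \<alpha> 1 1 *\<^sub>N nf_br n x (nf_x 1)"
proof -
  have y: "nf_y 1 \<in> nf_part n 1" "\<phi> (nf_y 1) (nf_y 1) \<in> nf_part n 0"
    using nf_basis_in_part(2)[of 1] n
      even_degree[OF nf_basis_in_part(2)[of 1] nf_basis_in_part(2)[of 1]] by auto
  have "nf_br n x (\<phi> (nf_y 1) (nf_y 1)) - nf_br n (\<phi> x (nf_y 1)) (nf_y 1)
      + sign 1 1 *\<^sub>N nf_br n (\<phi> x (nf_y 1)) (nf_y 1)
      + \<phi> x (nf_br n (nf_y 1) (nf_y 1)) - \<phi> (nf_br n x (nf_y 1)) (nf_y 1)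
      + sign 1 1 *\<^sub>N \<phi> (nf_br n x (nf_y 1)) (nf_y 1) = 0"
    by (rule cocycle_identity[OF cocycle assms y(1) y(1)])
  moreover have "nf_br n (nf_y 1) (nf_y 1) = (nf_x 1 :: 'f nf_vec)"
    using n by (simp add: nf_br_basis_1)
  ultimately show ?thesis
    unfolding nf_br_even[OF y(2)]
    by (auto simp: sign_def \<alpha>_def fun_eq_iff algebra_simps eq_neg_iff_add_eq_0)
qed

text \<open>Symmetrize over y_k and y_1: for k \<ge> 2 the product [y_1,y_k] vanishes, leaving
  [y_k,y_1] = x_k. The coefficient still involves \<phi>(y_1,y_k), which is evaluated only in
  \<open>right_x\<close>.\<close>

lemma right_x_aux:
  assumes x: "x \<in> nf_part n a" and k: "k \<in> {2..n}"
  shows "\<phi> x (nf_x k) = (\<phi> (nf_y 1) (nf_y k) (XI 1) - \<alpha> k 1) *\<^sub>N nf_br n x (nf_x 1)"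
proof -
  have y: "nf_y k \<in> nf_part n 1" "nf_y 1 \<in> nf_part n 1"
    using k by (auto intro: nf_basis_in_part)
  let ?v = "\<phi> (nf_y k) (nf_y 1) + sign 1 1 *\<^sub>N \<phi> (nf_y 1) (nf_y k)"
  have "nf_br n (nf_y k) (nf_y 1) + sign 1 1 *\<^sub>N nf_br n (nf_y 1) (nf_y k) = (nf_x k :: 'f nf_vec)"
    using k by (simp add: nf_br_basis_1)
  then have "\<phi> x (nf_x k) = - nf_br n x ?v"
    using cocycle_symmetrized[OF cocycle x y] by simp
  moreover have "?v \<in> nf_part n 0"
    using even_degree[OF y] even_degree[OF y(2,1)] subspace_part[of 0]
    by (simp add: subspace_add subspace_scale)
  then have "nf_br n x ?v = ?v (XI 1) *\<^sub>N nf_br n x (nf_x 1)"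
    by (rule nf_br_even)
  ultimately show ?thesis
    by (simp add: sign_def \<alpha>_def fun_eq_iff algebra_simps)
qed

text \<open>Symmetrize over x_j and y_1. The case j = n is kept, with 0 in place of the missing
  y_{n+1}, because there the equation becomes a constraint on \<open>\<beta> n 1\<close>.\<close>

lemma right_y_aux:
  assumes x: "x \<in> nf_part n a" and j: "j \<in> {1..n}"
  shows "(if j < n then \<phi> x (nf_y (j + 1)) else 0) = (- 2 * \<beta> j 1) *\<^sub>N nf_br n x (nf_y 1)"
proof -
  have y: "nf_x j \<in> nf_part n 0" "nf_y 1 \<in> nf_part n 1"
    using j by (auto intro: nf_basis_in_part)
  let ?v = "\<phi> (nf_x j) (nf_y 1) + sign 0 1 *\<^sub>N \<phi> (nf_y 1) (nf_x j)"
  have "?v \<in> nf_part n 1"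
    using even_degree[OF y] even_degree[OF y(2,1)] subspace_part[of 1]
    by (simp add: subspace_add subspace_scale)
  then have br_v: "nf_br n x ?v = ?v (YI 1) *\<^sub>N nf_br n x (nf_y 1)"
    by (rule nf_br_odd)
  \<comment> \<open>\<open>[x\<^sub>j,y\<^sub>1] + [y\<^sub>1,x\<^sub>j]\<close> is \<open>(1/2) y\<^sub>j\<^sub>+\<^sub>1\<close> plus, only for \<open>j = 1\<close>, another \<open>y\<^sub>2\<close>\<close>
  define c :: 'f where "c = (if j = 1 then 3 else 1)"
  have c: "c \<noteq> 0" by (simp add: c_def)
  \<comment> \<open>For j = 1, \<open>right_x1\<close> contributes 2\<phi>(x_1,y_1), hence twice
    \<open>\<beta> 1 1\<close>; for j \<ge> 2, \<open>right_x_aux\<close> gives a multiple of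
    [y_1,x_1], which has no y_1 coordinate.\<close>
  have "\<phi> (nf_y 1) (nf_x j) (YI 1) = (c - 1) * \<beta> j 1"
  proof (cases "j = 1")
    case True
    then show ?thesis
      using fun_cong[OF right_x1[OF y(2)], of "YI 1"] n
      by (simp add: nf_br_basis_1 nf_br_YI c_def \<beta>_def)
  next
    case False
    then show ?thesis
      using fun_cong[OF right_x_aux[OF y(2), of j], of "YI 1"] j by (simp add: nf_br_YI c_def)
  qed
  then have v: "?v (YI 1) = c * \<beta> j 1"
    by (simp add: sign_def \<beta>_def algebra_simps)
  have "nf_br n (nf_x j) (nf_y 1) + sign 0 1 *\<^sub>N nf_br n (nf_y 1) (nf_x j)
      = (c / 2) *\<^sub>N (if j < n then nf_y (j + 1) else 0)"
    using j n by (cases "j = 1") (auto simp: nf_br_basis_1 sign_def c_def fun_eq_iff)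
  then have "\<phi> x ((c / 2) *\<^sub>N (if j < n then nf_y (j + 1) else 0)) = - ((c * \<beta> j 1) *\<^sub>N nf_br n x (nf_y 1))"
    using cocycle_symmetrized[OF cocycle x y] br_v v by simp
  then have "(c / 2) *\<^sub>N (if j < n then \<phi> x (nf_y (j + 1)) else 0) = - ((c * \<beta> j 1) *\<^sub>N nf_br n x (nf_y 1))"
    using scale_right[OF x nf_basis_in_part(2)] zero_right[OF x] by (auto split: if_splits)
  \<comment> \<open>Coordinatewise, c is a common factor; it is 1 or 3, hence cancellable in
    characteristic zero.\<close>
  then have "c * (if j < n then \<phi> x (nf_y (j + 1)) else 0) p
      = c * ((- 2 * \<beta> j 1) *\<^sub>N nf_br n x (nf_y 1)) p" for p
    by (auto simp: fun_eq_iff field_simps)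
  then show ?thesis
    using c by (intro ext) (simp only: mult_cancel_left simp_thms)
qed

lemma right_y:
  assumes x: "x \<in> nf_part n a" and j: "j \<in> {1..n-1}"
  shows "\<phi> x (nf_y (j + 1)) = (- 2 * \<beta> j 1) *\<^sub>N nf_br n x (nf_y 1)"
proof -
  have "j \<in> {1..n}" "j < n" using j by auto
  then show ?thesis using right_y_aux[OF x, of j] by simp
qed

text \<open>\<open>right_y\<close> at x = y_1 supplies the unknown coefficient of
  \<open>right_x_aux\<close>, as [y_1,y_1] = x_1.\<close>

lemma right_x:
  assumes x: "x \<in> nf_part n a" and j: "j \<in> {1..n-1}"
  shows "\<phi> x (nf_x (j + 1)) = (- (\<alpha> (j + 1) 1 + 2 * \<beta> j 1)) *\<^sub>N nf_br n x (nf_x 1)"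
proof -
  have "\<phi> (nf_y 1) (nf_y (j + 1)) (XI 1) = - 2 * \<beta> j 1"
    using fun_cong[OF right_y[OF nf_basis_in_part(2) j, of 1], of "XI 1"] n by (simp add: nf_br_basis_1)
  moreover have "j + 1 \<in> {2..n}" using j by auto
  ultimately show ?thesis using right_x_aux[OF x] by simp
qed

text \<open>At x = y_1 and j = n, \<open>right_y_aux\<close> reads 0 = -2 \<open>\<beta> n 1\<close>
  x_1.\<close>

lemma \<beta>_n_1: "\<beta> n 1 = 0"
  using fun_cong[OF right_y_aux[OF nf_basis_in_part(2), of 1 n], of "XI 1"] n
  by (simp add: nf_br_basis_1)

section \<open>Explicit values at (., x_1) and assembly of the final form\<close>

lemma apply_x_x1:
  assumes j: "j \<in> {1..n}"
  shows "\<phi> (nf_x j) (nf_x 1) = (if j < n then (- \<alpha> 1 1) *\<^sub>N nf_x (j + 1) else 0)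
    + (\<Sum>k=1..n. ((if j < n then \<alpha> (j + 1) k else 0) + 2 * \<beta> j k) *\<^sub>N nf_x k)"
proof -
  \<comment> \<open>The factor 2 absorbs the 1/2 in [x_j,y_1], so the \<alpha> terms enter with
    coefficient 1.\<close>
  have "2 *\<^sub>N \<phi> (nf_br n (nf_x j) (nf_y 1)) (nf_y 1)
      = (if j < n then (\<Sum>k=1..n. \<alpha> (j + 1) k *\<^sub>N nf_x k) else 0)"
    using j n scale_left[OF nf_basis_in_part(2)[of "j + 1"] nf_basis_in_part(2)[of 1], of "1/2"]
      zero_left[OF nf_basis_in_part(2)[of 1]]
    by (auto simp: nf_br_basis_1 apply_y_y1 fun_eq_iff mult.commute)
  then show ?thesis
    unfolding right_x1[OF nf_basis_in_part(1)[OF j]]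
    using j n by (intro nf_vec_eqI)
      (auto simp: nf_br_basis_1 apply_x_y1 nf_br_XI nf_br_YI)
qed

text \<open>The shifted index k - 1 comes from multiplying \<phi>(y_j,y_1) by y_1, since
  2[x_{k-1},y_1] = y_k; the \<beta> terms come from [y_j,y_1] = x_j.\<close>

lemma apply_y_x1:
  assumes j: "j \<in> {1..n}"
  shows "\<phi> (nf_y j) (nf_x 1) = (2 * \<beta> j 1) *\<^sub>N nf_y 1
    + (if j < n then (- \<alpha> 1 1) *\<^sub>N nf_y (j + 1) else 0)
    + (\<Sum>k=2..n. (\<alpha> j (k - 1) + 2 * \<beta> j k) *\<^sub>N nf_y k)"
  unfolding right_x1[OF nf_basis_in_part(2)[OF j]]
  using j n by (intro nf_vec_eqI)
    (auto simp: nf_br_basis_1 apply_x_y1 apply_y_y1 nf_br_XI nf_br_YI)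

end

theorem proposition4p3:
  fixes n :: nat
    and \<phi> :: "'f::field_char_0 nf_vec \<Rightarrow> 'f nf_vec \<Rightarrow> 'f nf_vec"
  assumes "1 \<le> n"
    and "\<phi> \<in> even_2cocycles nf_scale (nf_part n) (nf_br n)"
  shows "\<exists>\<alpha> \<beta> :: nat \<Rightarrow> nat \<Rightarrow> 'f.
    (\<forall>j\<in>{1..n}. \<phi> (nf_y j) (nf_y 1) = (\<Sum>k=1..n. \<alpha> j k *\<^sub>N nf_x k)) \<and>
    (\<forall>j\<in>{1..n-1}. \<phi> (nf_x j) (nf_y 1) = (\<Sum>k=1..n. \<beta> j k *\<^sub>N nf_y k)) \<and>
    \<phi> (nf_x n) (nf_y 1) = (\<Sum>k=2..n. \<beta> n k *\<^sub>N nf_y k) \<and>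
    (\<forall>j\<in>{1..n-1}. \<phi> (nf_x j) (nf_x 1) =
      (- \<alpha> 1 1) *\<^sub>N nf_x (j + 1) + (\<Sum>k=1..n. (\<alpha> (j + 1) k + 2 * \<beta> j k) *\<^sub>N nf_x k)) \<and>
    \<phi> (nf_x n) (nf_x 1) = 2 *\<^sub>N (\<Sum>k=2..n. \<beta> n k *\<^sub>N nf_x k) \<and>
    (\<forall>j\<in>{1..n-1}. \<phi> (nf_y j) (nf_x 1) =
      (2 * \<beta> j 1) *\<^sub>N nf_y 1 + (- \<alpha> 1 1) *\<^sub>N nf_y (j + 1)
        + (\<Sum>k=2..n. (\<alpha> j (k - 1) + 2 * \<beta> j k) *\<^sub>N nf_y k)) \<and>
    \<phi> (nf_y n) (nf_x 1) = (\<Sum>k=2..n. (\<alpha> n (k - 1) + 2 * \<beta> n k) *\<^sub>N nf_y k) \<and>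
    (\<forall>i\<in>{1..n-1}. \<forall>j\<in>{1..n-1}. \<phi> (nf_x i) (nf_x (j + 1)) =
      (- (\<alpha> (j + 1) 1 + 2 * \<beta> j 1)) *\<^sub>N nf_x (i + 1)) \<and>
    (\<forall>i\<in>{1..n-1}. \<forall>j\<in>{1..n-1}. \<phi> (nf_y i) (nf_x (j + 1)) =
      (- (\<alpha> (j + 1) 1 + 2 * \<beta> j 1)) *\<^sub>N nf_y (i + 1)) \<and>
    (\<forall>i\<in>{1..n-1}. \<forall>j\<in>{1..n-1}. \<phi> (nf_x i) (nf_y (j + 1)) =
      (- \<beta> j 1) *\<^sub>N nf_y (i + 1)) \<and>
    (\<forall>i\<in>{1..n}. \<forall>j\<in>{1..n-1}. \<phi> (nf_y i) (nf_y (j + 1)) =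
      (- (2 * \<beta> j 1)) *\<^sub>N nf_x i) \<and>
    (\<comment> \<open>the pairs of basis elements not covered above\<close>
     \<forall>j\<in>{1..n-1}. \<phi> (nf_x n) (nf_x (j + 1)) = 0 \<and> \<phi> (nf_y n) (nf_x (j + 1)) = 0 \<and>
       \<phi> (nf_x n) (nf_y (j + 1)) = 0)"
proof -
  interpret nf_cocycle n \<phi> using assms by unfold_locales
  \<comment> \<open>In the values at x_n the first summand drops out by \<open>\<beta>_n_1\<close>,
    so those sums start at 2.\<close>
  have split_first: "(\<Sum>k=1..n. f k) = f 1 + (\<Sum>k=2..n. f k)" for f :: "nat \<Rightarrow> 'f nf_vec"
    using assms(1) by (simp add: sum.atLeast_Suc_atMost numeral_2_eq_2)
  show ?thesis
  proof (rule exI[of _ \<alpha>], rule exI[of _ \<beta>], intro conjI ballI)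
    fix j assume "j \<in> {1..n}"
    then show "\<phi> (nf_y j) (nf_y 1) = (\<Sum>k=1..n. \<alpha> j k *\<^sub>N nf_x k)" by (rule apply_y_y1)
  \<comment> \<open>The remaining pairs give 0 because they are multiples of [x_n,x_1], [y_n,x_1] or
    [x_n,y_1].\<close>
  qed (use n in \<open>auto simp: apply_x_y1 apply_x_x1 apply_y_x1
      right_x[OF nf_basis_in_part(1)] right_x[OF nf_basis_in_part(2)]
      right_y[OF nf_basis_in_part(1)] right_y[OF nf_basis_in_part(2)] nf_br_basis_1
      split_first \<beta>_n_1 scale_sum_right\<close>)
qed

end
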